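(* Let $X$ be a countably based $T_0$-space and $\rho\colon\subseteq\omega^\omega\to X$ an admissible representation of $X$. For all countable ordinals $\alpha,\theta>0$ and every $S\subseteq X$: $S\in D_\alpha(\mathbf{\Sigma}^0_\theta(X))$ if and only if $\rho^{-1}(S)\in D_\alpha(\mathbf{\Sigma}^0_\theta(\mathrm{dom}(\rho)))$, where $\mathrm{dom}(\rho)$ has the subspace topology from $\omega^\omega$.
   Context: $\omega^\omega$ has the product topology. A partial continuous $\rho\colon\subseteq\omega^\omega\to X$ is an admissible representation of $X$ if for every partial continuous $f\colon\subseteq\omega^\omega\to X$ there is a partial continuous $g\colon\subseteq\omega^\omega\to\omega^\omega$ with $f=\rho\circ g$. Borel hierarchy on a topological space $Z$: $\mathbf{\Sigma}^0_1(Z)$ = open sets; for $1<\alpha<\omega_1$, $\mathbf{\Sigma}^0_\alpha(Z)$ consists of sets $\bigcup_{i\in\omega}(B_i\setminus B_i')$ with $B_i,B_i'\in\mathbf{\Sigma}^0_{\beta_i}(Z)$, $\beta_i<\alpha$. Difference hierarchy: write an ordinal as $\alpha=\beta+n$ with $\beta$ a limit or $0$ and $n<\omega$; $r(\alpha)=0$ if $n$ is even, $1$ otherwise. For an increasing sequence $(A_\beta)_{\beta<\alpha}$ ($A_\gamma\subseteq A_\beta$ for $\gamma<\beta<\alpha$), $D_\alpha((A_\beta)_{\beta<\alpha})=\bigcup\{A_\beta\setminus\bigcup_{\gamma<\beta}A_\gamma\mid\beta<\alpha,\ r(\beta)\ne r(\alpha)\}$, and $D_\alpha(\mathbf{\Sigma}^0_\theta(Z))$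 is the class of all such sets with each $A_\beta\in\mathbf{\Sigma}^0_\theta(Z)$. *)

theory Defs
  imports "HOL-Analysis.Analysis"
begin

definition baire :: "(nat \<Rightarrow> nat) topology" where
  "baire = product_topology (\<lambda>_::nat. discrete_topology (UNIV::nat set)) UNIV"

definition pcont :: "(nat \<Rightarrow> nat) set \<Rightarrow> 'b topology \<Rightarrow> ((nat \<Rightarrow> nat) \<Rightarrow> 'b) \<Rightarrow> bool" where
  "pcont D Y f \<longleftrightarrow> continuous_map (subtopology baire D) Y f"

definition admissible_rep :: "'b topology \<Rightarrow> (nat \<Rightarrow> nat) set \<Rightarrow> ((nat \<Rightarrow> nat) \<Rightarrow> 'b) \<Rightarrow> bool" where
  "admissible_rep X D \<rho> \<longleftrightarrow> pcont D X \<rho> \<and>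
     (\<forall>Df f. pcont Df X f \<longrightarrow>
        (\<exists>Dg g. pcont Dg baire g \<and> Df = {p \<in> Dg. g p \<in> D} \<and> (\<forall>p \<in> Df. \<rho> (g p) = f p)))"

text \<open>Ordinals are modelled by elements of an arbitrary well-ordered type; the ordinal
  of an element \<alpha> is the order type of {\<beta>. \<beta> < \<alpha>}.\<close>
definition is_pred :: "'o::wellorder \<Rightarrow> 'o \<Rightarrow> bool" where
  "is_pred \<gamma> \<alpha> \<longleftrightarrow> \<gamma> < \<alpha> \<and> (\<forall>\<delta>. \<gamma> < \<delta> \<longrightarrow> \<alpha> \<le> \<delta>)"

text \<open>ord_parity \<alpha> b: writing \<alpha> = \<beta> + n with \<beta> limit or 0, b holds iff n is odd (r(\<alpha>) = 1).\<close>
inductive ord_parity :: "'o::wellorder \<Rightarrow> bool \<Rightarrow> bool" where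
  lim: "\<not> (\<exists>\<gamma>. is_pred \<gamma> \<alpha>) \<Longrightarrow> ord_parity \<alpha> False"
| step: "is_pred \<gamma> \<alpha> \<Longrightarrow> ord_parity \<gamma> b \<Longrightarrow> ord_parity \<alpha> (\<not> b)"

definition r_ord :: "'o::wellorder \<Rightarrow> nat" where
  "r_ord \<alpha> = (if ord_parity \<alpha> True then 1 else 0)"

text \<open>Borel classes: sigma0 Z \<theta> A means A \<in> \<Sigma>^0_\<theta>(Z), where \<theta> has ordinal \<ge> 1.
  Ordinal 1 = exactly one predecessor; ordinal > 1 = at least two predecessors.\<close>
inductive sigma0 :: "'a topology \<Rightarrow> 'o::wellorder \<Rightarrow> 'a set \<Rightarrow> bool" for Z where
  opn: "(\<exists>\<gamma>. {\<beta>. \<beta> < \<theta>} = {\<gamma>}) \<Longrightarrow> openin Z A \<Longrightarrow> sigma0 Z \<theta> A"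
| un: "(\<exists>\<gamma> \<delta>. \<gamma> < \<delta> \<and> \<delta> < \<theta>) \<Longrightarrow>
       (\<forall>i. \<beta> i < \<theta> \<and> (\<exists>\<gamma>. \<gamma> < \<beta> i) \<and> sigma0 Z (\<beta> i) (B i) \<and> sigma0 Z (\<beta> i) (B' i)) \<Longrightarrow>
       sigma0 Z \<theta> (\<Union>i::nat. B i - B' i)"

definition Dset :: "'o::wellorder \<Rightarrow> ('o \<Rightarrow> 'a set) \<Rightarrow> 'a set" where
  "Dset \<alpha> A = \<Union>{A \<beta> - (\<Union>\<gamma>\<in>{\<gamma>. \<gamma> < \<beta>}. A \<gamma>) | \<beta>. \<beta> < \<alpha> \<and> r_ord \<beta> \<noteq> r_ord \<alpha>}"

definition in_D_Sigma :: "'a topology \<Rightarrow> 'o::wellorder \<Rightarrow> 'p::wellorder \<Rightarrow> 'a set \<Rightarrow> bool" where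
  "in_D_Sigma Z \<alpha> \<theta> S \<longleftrightarrow> (\<exists>A. (\<forall>\<beta><\<alpha>. sigma0 Z \<theta> (A \<beta>)) \<and>
      (\<forall>\<gamma> \<beta>. \<gamma> < \<beta> \<and> \<beta> < \<alpha> \<longrightarrow> A \<gamma> \<subseteq> A \<beta>) \<and> S = Dset \<alpha> A)"

end

theory Submission
  imports Defs
begin

text \<open>
  Preservation under preimages is routine; the point is the converse.  Let \<open>f\<close> be the standard
  representation, which is continuous and open and has Polish fibres.  Given
  \<open>f\<^sup>-\<^sup>1(S) = D\<^sub>\<alpha>(A\<^sub>\<beta>)\<close>, replace each \<open>A\<^sub>\<beta>\<close> by its
  Vaught transform, the set of points on whose fibre \<open>A\<^sub>\<beta>\<close> is non-meagre.  The transform keeps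
  the Borel class.  If \<open>\<beta>\<close> is least such that \<open>x\<close> lies in the transform of \<open>A\<^sub>\<beta>\<close>, then
  \<open>A\<^sub>\<beta>\<close> minus all earlier sets still meets the fibre of \<open>x\<close>, so the parity of \<open>\<beta>\<close> decides
  whether \<open>x \<in> S\<close>; hence \<open>S\<close> is \<open>D\<^sub>\<alpha>\<close> of the transforms.
  Admissibility writes \<open>f\<close> as \<open>\<rho> \<circ> g\<close> with \<open>g\<close> continuous,
  which transfers the result to \<open>\<rho>\<close>.
\<close>

section \<open>Meagre sets and the Baire property\<close>

text \<open>The cover consists of closed sets, so passing to subsets is immediate and the Baire
  category theorem applies to the cover itself.\<close>

definition meagre_in :: "'a topology \<Rightarrow> 'a set \<Rightarrow> bool" where
  "meagre_in X M \<longleftrightarrow>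
     (\<exists>\<C>. countable \<C> \<and> (\<forall>C\<in>\<C>. closedin X C \<and> X interior_of C = {}) \<and> M \<subseteq> \<Union>\<C>)"

definition Baire_property_in :: "'a topology \<Rightarrow> 'a set \<Rightarrow> bool" where
  "Baire_property_in X A \<longleftrightarrow> (\<exists>G. openin X G \<and> meagre_in X ((A - G) \<union> (G - A)))"

lemma meagre_in_subset: "meagre_in X M \<Longrightarrow> N \<subseteq> M \<Longrightarrow> meagre_in X N"
  unfolding meagre_in_def by (meson order_trans)

lemma meagre_in_empty [simp]: "meagre_in X {}"
  unfolding meagre_in_def by (rule exI[of _ "{}"]) auto

lemma meagre_in_UN:
  assumes "countable I" "\<And>i. i \<in> I \<Longrightarrow> meagre_in X (M i)"
  shows "meagre_in X (\<Union>i\<in>I. M i)"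
proof -
  from assms(2) have "\<forall>i\<in>I. \<exists>\<C>. countable \<C> \<and>
      (\<forall>C\<in>\<C>. closedin X C \<and> X interior_of C = {}) \<and> M i \<subseteq> \<Union>\<C>"
    unfolding meagre_in_def by blast
  then obtain \<C> where \<C>: "\<forall>i\<in>I. countable (\<C> i) \<and>
      (\<forall>C\<in>\<C> i. closedin X C \<and> X interior_of C = {}) \<and> M i \<subseteq> \<Union>(\<C> i)"
    by metis
  show ?thesis
    unfolding meagre_in_def
  proof (intro exI[of _ "\<Union>i\<in>I. \<C> i"] conjI)
    show "countable (\<Union>i\<in>I. \<C> i)"
      by (rule countable_UN[OF assms(1)]) (use \<C> in blast)
    show "\<forall>C\<in>\<Union>i\<in>I. \<C> i. closedin X C \<and> X interior_of C = {}"
      using \<C> by blast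
    show "(\<Union>i\<in>I. M i) \<subseteq> \<Union>(\<Union>i\<in>I. \<C> i)"
      using \<C> by fastforce
  qed
qed

lemma meagre_in_Un: "meagre_in X M \<Longrightarrow> meagre_in X N \<Longrightarrow> meagre_in X (M \<union> N)"
  using meagre_in_UN[of "{M, N}" X "\<lambda>M. M"] by auto

text \<open>An open set meeting the closure of \<open>G\<close> meets \<open>G\<close>. This bounds
  the error made when the complement of \<open>G\<close> is replaced by its interior.\<close>

lemma meagre_in_frontier_of_open:
  assumes "openin X G"
  shows "meagre_in X (X closure_of G - G)"
proof -
  have cl: "closedin X (X closure_of G - G)"
    using assms by (intro closedin_diff closedin_closure_of)
  have "X interior_of (X closure_of G - G) = {}"
  proof (rule ccontr)
    assume "X interior_of (X closure_of G - G) \<noteq> {}"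
    then obtain x W where "openin X W" "x \<in> W" "W \<subseteq> X closure_of G - G"
      by (auto simp: interior_of_def)
    moreover from this have "x \<in> X closure_of G" by blast
    ultimately have "\<exists>y. y \<in> G \<and> y \<in> W"
      unfolding in_closure_of by blast
    with \<open>W \<subseteq> X closure_of G - G\<close> show False by blast
  qed
  with cl show ?thesis
    unfolding meagre_in_def by (intro exI[of _ "{X closure_of G - G}"]) auto
qed

lemma Baire_category_openin:
  assumes "completely_metrizable_space X" "openin X G" "meagre_in X G"
  shows "G = {}"
proof -
  obtain \<C> where "countable \<C>" "\<forall>C\<in>\<C>. closedin X C \<and> X interior_of C = {}" "G \<subseteq> \<Union>\<C>"
    using assms(3) unfolding meagre_in_def by blast
  then have "X interior_of \<Union>\<C> = {}" "G \<subseteq> \<Union>\<C>"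
    using Baire_category_alt[of X \<C>] assms(1) by auto
  then show ?thesis
    using assms(2) interior_of_maximal by fastforce
qed

lemma Baire_property_in_openin: "openin X G \<Longrightarrow> Baire_property_in X G"
  unfolding Baire_property_in_def by (rule exI[of _ G]) auto

text \<open>\<open>G - H\<close> need not be open, so the open approximation is \<open>G\<close>
  minus the closure of \<open>H\<close>; the extra error lies in the frontier of \<open>H\<close>,
  which is meagre.\<close>

lemma Baire_property_in_Diff:
  assumes "Baire_property_in X A" "Baire_property_in X B"
  shows "Baire_property_in X (A - B)"
proof -
  obtain G H where G: "openin X G" "meagre_in X ((A - G) \<union> (G - A))"
    and H: "openin X H" "meagre_in X ((B - H) \<union> (H - B))"
    using assms unfolding Baire_property_in_def by blast
  have sub: "H \<subseteq> X closure_of H"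
    by (simp add: H(1) closure_of_subset openin_subset)
  have "meagre_in X (((A - G) \<union> (G - A)) \<union> (((B - H) \<union> (H - B)) \<union> (X closure_of H - H)))"
    by (intro meagre_in_Un G(2) H(2) meagre_in_frontier_of_open[OF H(1)])
  then have "meagre_in X (((A - B) - (G - X closure_of H)) \<union> ((G - X closure_of H) - (A - B)))"
    by (rule meagre_in_subset) (use sub in blast)
  moreover have "openin X (G - X closure_of H)"
    using G(1) by (intro openin_diff closedin_closure_of)
  ultimately show ?thesis
    unfolding Baire_property_in_def by blast
qed

lemma Baire_property_in_UN:
  assumes "countable I" "\<And>i. i \<in> I \<Longrightarrow> Baire_property_in X (A i)"
  shows "Baire_property_in X (\<Union>i\<in>I. A i)"
proof -
  from assms(2) have "\<forall>i\<in>I. \<exists>G. openin X G \<and> meagre_in X ((A i - G) \<union> (G - A i))"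
    unfolding Baire_property_in_def by blast
  from bchoice[OF this] obtain G
    where G: "\<forall>i\<in>I. openin X (G i) \<and> meagre_in X ((A i - G i) \<union> (G i - A i))" ..
  have "meagre_in X (\<Union>i\<in>I. (A i - G i) \<union> (G i - A i))"
    using G by (intro meagre_in_UN[OF assms(1)]) blast
  then have "meagre_in X (((\<Union>i\<in>I. A i) - (\<Union>i\<in>I. G i)) \<union> ((\<Union>i\<in>I. G i) - (\<Union>i\<in>I. A i)))"
    by (rule meagre_in_subset) blast
  moreover have "openin X (\<Union>i\<in>I. G i)"
    using G by (intro openin_Union) blast
  ultimately show ?thesis
    unfolding Baire_property_in_def by blast
qed

section \<open>Borel classes and continuous preimages\<close>

text \<open>Pairing flattens the double union into the single one of \<open>sigma0.un\<close>. The
  transform of a union of differences arises in this double form.\<close>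

lemma sigma0_UN_countable:
  assumes "\<exists>\<gamma> \<delta>. \<gamma> < \<delta> \<and> \<delta> < \<theta>"
    and "\<And>i j. \<beta> i < \<theta> \<and> (\<exists>\<gamma>. \<gamma> < \<beta> i) \<and> sigma0 Z (\<beta> i) (B i j) \<and> sigma0 Z (\<beta> i) (B' i j)"
  shows "sigma0 Z \<theta> (\<Union>i::nat. \<Union>j::nat. B i j - B' i j)"
proof -
  define d where "d = (prod_decode :: nat \<Rightarrow> nat \<times> nat)"
  have d: "range d = UNIV"
    by (simp add: d_def surj_prod_decode)
  have "sigma0 Z \<theta> (\<Union>n. B (fst (d n)) (snd (d n)) - B' (fst (d n)) (snd (d n)))"
    by (rule sigma0.un[where \<beta> = "\<lambda>n. \<beta> (fst (d n))"]) (use assms in auto)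
  also have "(\<Union>n. B (fst (d n)) (snd (d n)) - B' (fst (d n)) (snd (d n)))
      = (\<Union>p\<in>range d. B (fst p) (snd p) - B' (fst p) (snd p))"
    by blast
  also have "\<dots> = (\<Union>i. \<Union>j. B i j - B' i j)"
    unfolding d by (simp add: set_eq_iff split_paired_Ex)
  finally show ?thesis .
qed

text \<open>Preimages commute with unions and differences. With \<open>g = id\<close> on a subspace
  this also restricts a class to a fibre.\<close>

lemma sigma0_vimage:
  assumes "sigma0 W \<theta> A" "continuous_map Z W g"
  shows "sigma0 Z \<theta> {z \<in> topspace Z. g z \<in> A}"
  using assms(1)
proof induction
  case (opn \<theta> A)
  then show ?case
    by (intro sigma0.opn openin_continuous_map_preimage[OF assms(2)])
next
  case (un \<theta> \<beta> B B')
  have "sigma0 Z \<theta> (\<Union>i. {z \<in> topspace Z. g z \<in> B i} - {z \<in> topspace Z. g z \<in> B' i})"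
    by (rule sigma0.un[where \<beta> = \<beta>]) (use un in auto)
  also have "(\<Union>i. {z \<in> topspace Z. g z \<in> B i} - {z \<in> topspace Z. g z \<in> B' i})
      = {z \<in> topspace Z. g z \<in> (\<Union>i. B i - B' i)}"
    by auto
  finally show ?case .
qed

lemma mem_Dset_iff:
  "x \<in> Dset \<alpha> A \<longleftrightarrow>
     (\<exists>\<beta><\<alpha>. r_ord \<beta> \<noteq> r_ord \<alpha> \<and> x \<in> A \<beta> \<and> (\<forall>\<gamma><\<beta>. x \<notin> A \<gamma>))"
  unfolding Dset_def by blast

lemma in_D_Sigma_vimage:
  assumes "in_D_Sigma W \<alpha> \<theta> S" "continuous_map Z W g"
  shows "in_D_Sigma Z \<alpha> \<theta> {z \<in> topspace Z. g z \<in> S}"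
proof -
  obtain A where A: "\<forall>\<beta><\<alpha>. sigma0 W \<theta> (A \<beta>)" "\<forall>\<gamma> \<beta>. \<gamma> < \<beta> \<and> \<beta> < \<alpha> \<longrightarrow> A \<gamma> \<subseteq> A \<beta>"
    "S = Dset \<alpha> A"
    using assms(1) unfolding in_D_Sigma_def by blast
  show ?thesis
    unfolding in_D_Sigma_def
  proof (intro exI[of _ "\<lambda>\<beta>. {z \<in> topspace Z. g z \<in> A \<beta>}"] conjI)
    show "{z \<in> topspace Z. g z \<in> S} = Dset \<alpha> (\<lambda>\<beta>. {z \<in> topspace Z. g z \<in> A \<beta>})"
      unfolding A(3) set_eq_iff mem_Collect_eq mem_Dset_iff by blast
  qed (use A sigma0_vimage[OF _ assms(2)] in blast)+
qed

lemma sigma0_imp_Baire_property_in: "sigma0 X \<theta> A \<Longrightarrow> Baire_property_in X A"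
proof (induction rule: sigma0.induct)
  case (opn \<theta> A)
  then show ?case by (simp add: Baire_property_in_openin)
next
  case (un \<theta> \<beta> B B')
  then show ?case by (intro Baire_property_in_UN Baire_property_in_Diff) auto
qed

section \<open>Open surjections with completely metrizable fibres\<close>

text \<open>Complete metrizability is asked of the fibres rather than of \<open>Z\<close>: the
  domain of the standard representation can be as complicated as \<open>X\<close>, while its fibres
  stay Polish.\<close>

locale open_surjection_complete_fibres =
  fixes Z :: "'z topology" and X :: "'x topology" and f :: "'z \<Rightarrow> 'x"
  assumes open_map: "open_map Z X f"
    and surj: "f ` topspace Z = topspace X"
    and second_countable: "second_countable Z"
    and complete_fibre: "x \<in> topspace X \<Longrightarrow>
      completely_metrizable_space (subtopology Z {z \<in> topspace Z. f z = x})"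
begin

section \<open>Vaught transforms along the fibres\<close>

definition fibre :: "'x \<Rightarrow> 'z set" where
  "fibre x = {z \<in> topspace Z. f z = x}"

text \<open>The existential Vaught transform, localised to \<open>U\<close>; the localisation is
  what allows differences to be handled by induction.\<close>

definition star :: "'z set \<Rightarrow> 'z set \<Rightarrow> 'x set" where
  "star A U = {x \<in> topspace X. \<not> meagre_in (subtopology Z (fibre x)) (A \<inter> U \<inter> fibre x)}"

text \<open>By Baire category a relatively open part of a fibre is meagre only if it is empty, so
  for open sets the transform is just the image.\<close>

lemma star_openin:
  assumes "openin Z A" "openin Z U"
  shows "star A U = f ` (A \<inter> U)"
proof -
  have "meagre_in (subtopology Z (fibre x)) (A \<inter> U \<inter> fibre x) \<longleftrightarrow> A \<inter> U \<inter> fibre x = {}"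
    if "x \<in> topspace X" for x
  proof -
    have "openin (subtopology Z (fibre x)) (A \<inter> U \<inter> fibre x)"
      using assms by (auto simp: openin_subtopology)
    then show ?thesis
      using Baire_category_openin complete_fibre[OF that, folded fibre_def] by fastforce
  qed
  moreover have "A \<subseteq> topspace Z"
    using assms(1) openin_subset by blast
  ultimately show ?thesis
    using surj by (auto simp: star_def fibre_def)
qed

lemma countable_base:
  obtains V :: "nat \<Rightarrow> 'z set"
  where "\<And>j. openin Z (V j)" "\<And>W z. openin Z W \<Longrightarrow> z \<in> W \<Longrightarrow> \<exists>j. z \<in> V j \<and> V j \<subseteq> W"
proof -
  obtain \<B> where \<B>: "countable \<B>" "\<forall>V \<in> \<B>. openin Z V"
    "\<forall>U x. openin Z U \<and> x \<in> U \<longrightarrow> (\<exists>V \<in> \<B>. x \<in> V \<and> V \<subseteq> U)"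
    using second_countable unfolding second_countable_def by blast
  \<comment> \<open>Adding the empty set makes the base non-empty, so that it can be enumerated by
    all of \<open>nat\<close>.\<close>
  have "range (from_nat_into (insert {} \<B>)) = insert {} \<B>"
    using \<B>(1) by (simp add: range_from_nat_into)
  with \<B> show thesis
    by (intro that[of "from_nat_into (insert {} \<B>)"]) (metis insertE openin_empty rangeI, metis insertI2 rangeE)
qed

text \<open>If \<open>B - B'\<close> is non-meagre in \<open>U\<close> on a fibre, then the Baire property of \<open>B'\<close> yields
  a basic \<open>V j\<close> in which \<open>B\<close> is non-meagre but \<open>B'\<close> is meagre.\<close>
lemma star_Diff:
  assumes B': "sigma0 Z \<theta> B'" and U: "openin Z U"
    and V: "\<And>j::nat. openin Z (V j)" "\<And>W z. openin Z W \<Longrightarrow> z \<in> W \<Longrightarrow> \<exists>j. z \<in> V j \<and> V j \<subseteq> W"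
  shows "star (B - B') U = (\<Union>j. star B (U \<inter> V j) - star B' (U \<inter> V j))"
proof (intro equalityI subsetI)
  fix x assume "x \<in> star (B - B') U"
  then have x: "x \<in> topspace X"
    and nm: "\<not> meagre_in (subtopology Z (fibre x)) ((B - B') \<inter> U \<inter> fibre x)"
    by (auto simp: star_def)
  let ?F = "subtopology Z (fibre x)"
  have ts: "topspace ?F = fibre x"
    by (auto simp: fibre_def)
  have "continuous_map ?F Z id"
    by (simp add: continuous_map_from_subtopology)
  from sigma0_vimage[OF B' this] have "sigma0 ?F \<theta> (B' \<inter> fibre x)"
    unfolding ts by (simp add: Collect_conj_eq Int_commute)
  then obtain G where G: "openin ?F G"
    and GB: "meagre_in ?F ((B' \<inter> fibre x - G) \<union> (G - B' \<inter> fibre x))"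
    using sigma0_imp_Baire_property_in unfolding Baire_property_in_def by blast
  \<comment> \<open>Off the closure of \<open>G\<close> only \<open>B' - G\<close> is left of
    \<open>B'\<close>, so \<open>B'\<close> is meagre there. \<open>H\<close> is an open set of
    \<open>Z\<close> cutting out this region.\<close>
  have "openin ?F (fibre x - ?F closure_of G)"
    using ts by (metis closedin_closure_of openin_diff openin_topspace)
  then obtain H where H: "openin Z H" "fibre x - ?F closure_of G = H \<inter> fibre x"
    by (auto simp: openin_subtopology)
  \<comment> \<open>Otherwise \<open>B - B'\<close> would be meagre in \<open>U\<close>: its part in
    \<open>H\<close> is covered by countably many meagre pieces, and the rest lies in
    \<open>G - B'\<close> or in the frontier of \<open>G\<close>.\<close>
  have "\<exists>j. V j \<subseteq> H \<and> \<not> meagre_in ?F (B \<inter> (U \<inter> V j) \<inter> fibre x)"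
  proof (rule ccontr)
    assume "\<not> ?thesis"
    then have "meagre_in ?F (\<Union>j\<in>{j. V j \<subseteq> H}. B \<inter> (U \<inter> V j) \<inter> fibre x)"
      by (intro meagre_in_UN) auto
    then have "meagre_in ?F ((\<Union>j\<in>{j. V j \<subseteq> H}. B \<inter> (U \<inter> V j) \<inter> fibre x) \<union>
        (((B' \<inter> fibre x - G) \<union> (G - B' \<inter> fibre x)) \<union> (?F closure_of G - G)))"
      by (intro meagre_in_Un GB meagre_in_frontier_of_open[OF G])
    moreover have "(B - B') \<inter> U \<inter> fibre x \<subseteq> (\<Union>j\<in>{j. V j \<subseteq> H}. B \<inter> (U \<inter> V j) \<inter> fibre x) \<union>
        (((B' \<inter> fibre x - G) \<union> (G - B' \<inter> fibre x)) \<union> (?F closure_of G - G))"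
    proof
      fix z assume z: "z \<in> (B - B') \<inter> U \<inter> fibre x"
      show "z \<in> (\<Union>j\<in>{j. V j \<subseteq> H}. B \<inter> (U \<inter> V j) \<inter> fibre x) \<union>
        (((B' \<inter> fibre x - G) \<union> (G - B' \<inter> fibre x)) \<union> (?F closure_of G - G))"
      proof (cases "z \<in> ?F closure_of G")
        case True
        with z show ?thesis by auto
      next
        case False
        with z H(2) have "z \<in> H" by blast
        with V(2)[OF H(1)] obtain j where "z \<in> V j" "V j \<subseteq> H" by blast
        with z show ?thesis by blast
      qed
    qed
    ultimately show False
      using nm meagre_in_subset by blast
  qed
  then obtain j where j: "V j \<subseteq> H" "\<not> meagre_in ?F (B \<inter> (U \<inter> V j) \<inter> fibre x)"
    by blast
  have "G \<subseteq> ?F closure_of G"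
    by (rule closure_of_subset[OF openin_subset[OF G]])
  with j(1) H(2) have "B' \<inter> (U \<inter> V j) \<inter> fibre x \<subseteq> (B' \<inter> fibre x - G) \<union> (G - B' \<inter> fibre x)"
    by blast
  with GB have "meagre_in ?F (B' \<inter> (U \<inter> V j) \<inter> fibre x)"
    using meagre_in_subset by blast
  with j x show "x \<in> (\<Union>j. star B (U \<inter> V j) - star B' (U \<inter> V j))"
    by (auto simp: star_def)
next
  fix x assume "x \<in> (\<Union>j. star B (U \<inter> V j) - star B' (U \<inter> V j))"
  then obtain j where x: "x \<in> topspace X"
    and nm: "\<not> meagre_in (subtopology Z (fibre x)) (B \<inter> (U \<inter> V j) \<inter> fibre x)"
    and m: "meagre_in (subtopology Z (fibre x)) (B' \<inter> (U \<inter> V j) \<inter> fibre x)"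
    by (auto simp: star_def)
  have "\<not> meagre_in (subtopology Z (fibre x)) ((B - B') \<inter> U \<inter> fibre x)"
  proof
    assume "meagre_in (subtopology Z (fibre x)) ((B - B') \<inter> U \<inter> fibre x)"
    from meagre_in_Un[OF this m] have "meagre_in (subtopology Z (fibre x)) (B \<inter> (U \<inter> V j) \<inter> fibre x)"
      by (rule meagre_in_subset) blast
    with nm show False ..
  qed
  with x show "x \<in> star (B - B') U"
    by (simp add: star_def)
qed

text \<open>Non-meagreness of a countable union means non-meagreness of some member, as meagre sets
  form a sigma-ideal.\<close>

lemma star_UN:
  assumes "countable I"
  shows "star (\<Union>i\<in>I. A i) U = (\<Union>i\<in>I. star (A i) U)"
proof -
  have *: "meagre_in (subtopology Z (fibre x)) ((\<Union>i\<in>I. A i) \<inter> U \<inter> fibre x) \<longleftrightarrow>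
      (\<forall>i\<in>I. meagre_in (subtopology Z (fibre x)) (A i \<inter> U \<inter> fibre x))" (is "?l \<longleftrightarrow> ?r") for x
  proof
    assume l: ?l
    show ?r
      by (intro ballI meagre_in_subset[OF l]) blast
  next
    assume ?r
    then have "meagre_in (subtopology Z (fibre x)) (\<Union>i\<in>I. A i \<inter> U \<inter> fibre x)"
      by (intro meagre_in_UN[OF assms]) blast
    then show ?l by (rule meagre_in_subset) blast
  qed
  show ?thesis
    unfolding star_def * by blast
qed

text \<open>The induction must range over all \<open>U\<close>, because \<open>star_Diff\<close>
  shrinks \<open>U\<close> to \<open>U \<inter> V j\<close>. The indices \<open>\<beta> i\<close>
  are unchanged, so the level is kept.\<close>

lemma sigma0_star:
  assumes "sigma0 Z \<theta> A" "openin Z U"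
  shows "sigma0 X \<theta> (star A U)"
  using assms
proof (induction arbitrary: U)
  case (opn \<theta> A)
  then show ?case
    using open_map unfolding open_map_def by (intro sigma0.opn) (auto simp: star_openin)
next
  case (un \<theta> \<beta> B B')
  obtain V where V: "\<And>j::nat. openin Z (V j)"
    "\<And>W z. openin Z W \<Longrightarrow> z \<in> W \<Longrightarrow> \<exists>j. z \<in> V j \<and> V j \<subseteq> W"
    using countable_base by metis
  have "star (\<Union>i. B i - B' i) U = (\<Union>i. star (B i - B' i) U)"
    by (rule star_UN) simp
  also have "\<dots> = (\<Union>i. \<Union>j. star (B i) (U \<inter> V j) - star (B' i) (U \<inter> V j))"
  proof (rule SUP_cong[OF refl])
    fix i
    have "sigma0 Z (\<beta> i) (B' i)"
      using un.IH by blast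
    then show "star (B i - B' i) U = (\<Union>j. star (B i) (U \<inter> V j) - star (B' i) (U \<inter> V j))"
      using un.prems V by (rule star_Diff)
  qed
  finally have eq: "star (\<Union>i. B i - B' i) U =
    (\<Union>i. \<Union>j. star (B i) (U \<inter> V j) - star (B' i) (U \<inter> V j))" .
  have UV: "openin Z (U \<inter> V j)" for j
    using un.prems V(1) by (rule openin_Int)
  show ?case
    unfolding eq
  proof (rule sigma0_UN_countable[where \<beta> = \<beta>])
    fix i j
    show "\<beta> i < \<theta> \<and> (\<exists>\<gamma>. \<gamma> < \<beta> i) \<and>
        sigma0 X (\<beta> i) (star (B i) (U \<inter> V j)) \<and> sigma0 X (\<beta> i) (star (B' i) (U \<inter> V j))"
      using un.IH[rule_format, of i] UV[of j] by blast
  qed (rule un.hyps)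
qed

text \<open>Countability of \<open>\<alpha>\<close> makes unions of fewer than or exactly
  \<open>\<alpha>\<close> many meagre sets meagre; this serves both \<open>layer\<close> and
  \<open>S_layer\<close>.\<close>

lemma in_D_Sigma_of_vimage:
  assumes D: "in_D_Sigma Z \<alpha> \<theta> {z \<in> topspace Z. f z \<in> S}"
    and \<alpha>: "countable {\<beta>. \<beta> < \<alpha>}" and S: "S \<subseteq> topspace X"
  shows "in_D_Sigma X \<alpha> \<theta> S"
proof -
  from D obtain A where A: "\<forall>\<beta><\<alpha>. sigma0 Z \<theta> (A \<beta>)" "\<forall>\<gamma> \<beta>. \<gamma> < \<beta> \<and> \<beta> < \<alpha> \<longrightarrow> A \<gamma> \<subseteq> A \<beta>"
    and SA': "{z \<in> topspace Z. f z \<in> S} = Dset \<alpha> A"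
    unfolding in_D_Sigma_def by (elim exE conjE)
  have SA: "z \<in> Dset \<alpha> A \<longleftrightarrow> z \<in> topspace Z \<and> f z \<in> S" for z
    unfolding SA'[symmetric] by simp
  define T where "T \<beta> = star (A \<beta>) (topspace Z)" for \<beta>
  have T_iff: "x \<in> T \<beta> \<longleftrightarrow> x \<in> topspace X \<and> \<not> meagre_in (subtopology Z (fibre x)) (A \<beta> \<inter> fibre x)"
    for x \<beta>
  proof -
    have "A \<beta> \<inter> topspace Z \<inter> fibre x = A \<beta> \<inter> fibre x"
      by (auto simp: fibre_def)
    then show ?thesis by (simp add: T_def star_def)
  qed
  have layer: "x \<in> S \<longleftrightarrow> r_ord \<beta> \<noteq> r_ord \<alpha>"
    if \<beta>: "\<beta> < \<alpha>" "x \<in> T \<beta>" "\<And>\<gamma>. \<gamma> < \<beta> \<Longrightarrow> x \<notin> T \<gamma>" for x \<beta>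
  proof -
    from \<beta>(2) have x: "x \<in> topspace X" by (simp add: T_iff)
    have "countable {\<gamma>. \<gamma> < \<beta>}"
      by (rule countable_subset[OF _ \<alpha>]) (use \<beta>(1) in auto)
    then have "meagre_in (subtopology Z (fibre x)) (\<Union>\<gamma>\<in>{\<gamma>. \<gamma> < \<beta>}. A \<gamma> \<inter> fibre x)"
      using \<beta>(3) x by (intro meagre_in_UN) (auto simp: T_iff)
    \<comment> \<open>\<open>A \<beta>\<close> is non-meagre on the fibre while all earlier sets
      together are meagre, so some \<open>z\<close> over \<open>x\<close> first enters the sequence
      at \<open>\<beta>\<close>.\<close>
    from meagre_in_subset[OF this] have "\<not> A \<beta> \<inter> fibre x \<subseteq> (\<Union>\<gamma>\<in>{\<gamma>. \<gamma> < \<beta>}. A \<gamma> \<inter> fibre x)"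
      using \<beta>(2)[unfolded T_iff] by blast
    then obtain z where z: "z \<in> A \<beta>" "z \<in> fibre x" "\<And>\<gamma>. \<gamma> < \<beta> \<Longrightarrow> z \<notin> A \<gamma>"
      by auto
    \<comment> \<open>The preimage of \<open>S\<close> contains a fibre entirely or misses it, so
      the single point \<open>z\<close> decides for \<open>x\<close>.\<close>
    have "x \<in> S \<longleftrightarrow> z \<in> Dset \<alpha> A"
      using z(2) by (auto simp: fibre_def SA)
    also have "\<dots> \<longleftrightarrow> r_ord \<beta> \<noteq> r_ord \<alpha>"
    proof
      assume "z \<in> Dset \<alpha> A"
      then obtain \<delta> where \<delta>: "\<delta> < \<alpha>" "r_ord \<delta> \<noteq> r_ord \<alpha>" "z \<in> A \<delta>" "\<And>\<gamma>. \<gamma> < \<delta> \<Longrightarrow> z \<notin> A \<gamma>"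
        unfolding mem_Dset_iff by blast
      have "\<delta> = \<beta>"
        using \<delta>(3,4) z(1,3) by (meson linorder_neqE)
      with \<delta>(2) show "r_ord \<beta> \<noteq> r_ord \<alpha>" by simp
    next
      assume "r_ord \<beta> \<noteq> r_ord \<alpha>"
      with z \<beta>(1) show "z \<in> Dset \<alpha> A"
        unfolding mem_Dset_iff by blast
    qed
    finally show ?thesis .
  qed
  \<comment> \<open>If no transform contained \<open>x\<close>, its whole fibre would be meagre in
    itself, hence empty by Baire category, against surjectivity.\<close>
  have S_layer: "\<exists>\<beta><\<alpha>. x \<in> T \<beta>" if "x \<in> S" for x
  proof (rule ccontr)
    assume "\<not> ?thesis"
    with that S have "\<And>\<beta>. \<beta> < \<alpha> \<Longrightarrow> meagre_in (subtopology Z (fibre x)) (A \<beta> \<inter> fibre x)"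
      by (auto simp: T_iff)
    with \<alpha> have m: "meagre_in (subtopology Z (fibre x)) (\<Union>\<beta>\<in>{\<beta>. \<beta> < \<alpha>}. A \<beta> \<inter> fibre x)"
      by (intro meagre_in_UN) auto
    have "fibre x \<subseteq> Dset \<alpha> A"
      using that by (auto simp: fibre_def SA)
    also have "\<dots> \<subseteq> (\<Union>\<beta>\<in>{\<beta>. \<beta> < \<alpha>}. A \<beta>)"
      unfolding Dset_def by blast
    finally have "meagre_in (subtopology Z (fibre x)) (fibre x)"
      by (intro meagre_in_subset[OF m]) blast
    moreover have "openin (subtopology Z (fibre x)) (fibre x)"
      by (auto simp: openin_subtopology fibre_def)
    ultimately have "fibre x = {}"
      using complete_fibre[folded fibre_def] that S by (metis Baire_category_openin subsetD)
    moreover have "x \<in> f ` topspace Z"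
      using surj that S by auto
    ultimately show False
      by (auto simp: fibre_def)
  qed
  show ?thesis
    unfolding in_D_Sigma_def
  proof (intro exI[of _ T] conjI allI impI)
    fix \<beta> assume "\<beta> < \<alpha>"
    then show "sigma0 X \<theta> (T \<beta>)"
      using A(1) by (simp add: T_def sigma0_star)
  next
    fix \<gamma> \<beta> assume "\<gamma> < \<beta> \<and> \<beta> < \<alpha>"
    then have "A \<gamma> \<subseteq> A \<beta>" using A(2) by blast
    then have sub: "A \<gamma> \<inter> fibre x \<subseteq> A \<beta> \<inter> fibre x" for x by blast
    show "T \<gamma> \<subseteq> T \<beta>"
    proof
      fix x assume "x \<in> T \<gamma>"
      with meagre_in_subset[OF _ sub[of x]] show "x \<in> T \<beta>"
        unfolding T_iff by blast
    qed
  next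
    have "x \<in> S \<longleftrightarrow> x \<in> Dset \<alpha> T" for x
    proof
      assume x: "x \<in> S"
      \<comment> \<open>The minimum is over the whole type; the witness \<open>\<delta>\<close> from
        \<open>S_layer\<close> keeps it below \<open>\<alpha>\<close>.\<close>
      define \<beta> where "\<beta> = (LEAST \<beta>. x \<in> T \<beta>)"
      from S_layer[OF x] obtain \<delta> where "\<delta> < \<alpha>" "x \<in> T \<delta>" by blast
      then have \<beta>: "\<beta> < \<alpha>" "x \<in> T \<beta>"
        unfolding \<beta>_def by (meson LeastI Least_le le_less_trans)+
      have \<beta>_least: "x \<notin> T \<gamma>" if "\<gamma> < \<beta>" for \<gamma>
        using that unfolding \<beta>_def by (rule not_less_Least)
      with layer[OF \<beta> \<beta>_least] x \<beta> show "x \<in> Dset \<alpha> T"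
        unfolding mem_Dset_iff by blast
    next
      assume "x \<in> Dset \<alpha> T"
      then show "x \<in> S"
        unfolding mem_Dset_iff using layer by blast
    qed
    then show "S = Dset \<alpha> T" by blast
  qed
qed

end

section \<open>The standard representation\<close>

lemma topspace_baire [simp]: "topspace baire = UNIV"
  by (simp add: baire_def)

lemma openin_baire_eval: "openin baire {p. p k \<in> M}"
proof -
  have "continuous_map baire (discrete_topology UNIV) (\<lambda>p. p k)"
    unfolding baire_def by (rule continuous_map_product_projection) simp
  from openin_continuous_map_preimage[OF this, of M] show ?thesis
    by simp
qed

lemma openin_baire_range: "openin baire (\<Union>k. {p. p k \<in> M})"
  by (rule openin_Union) (elim imageE, simp only: openin_baire_eval)

text \<open>A basic open box constrains only finitely many coordinates, and \<open>n\<close> is a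
  strict bound for these.\<close>

lemma openin_baire_cylinder:
  assumes "openin baire W" "p \<in> W"
  shows "\<exists>n. \<forall>q. (\<forall>k<n. q k = p k) \<longrightarrow> q \<in> W"
proof -
  have "\<forall>x\<in>W. \<exists>U. finite {i \<in> UNIV. U i \<noteq> topspace (discrete_topology UNIV)} \<and>
      (\<forall>i\<in>UNIV. openin (discrete_topology UNIV) (U i)) \<and> x \<in> PiE UNIV U \<and> PiE UNIV U \<subseteq> W"
    using assms(1) unfolding baire_def openin_product_topology_alt .
  from bspec[OF this assms(2)] obtain U
    where fin: "finite {i \<in> UNIV. U i \<noteq> topspace (discrete_topology UNIV)}"
      and U: "p \<in> PiE UNIV U" "PiE UNIV U \<subseteq> W"
    by (elim exE conjE)
  from fin obtain n where "\<forall>i\<in>{i \<in> UNIV. U i \<noteq> topspace (discrete_topology UNIV)}. i < n"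
    unfolding finite_nat_set_iff_bounded ..
  then have n: "i < n" if "U i \<noteq> UNIV" for i
    using that by simp
  have "q \<in> W" if q: "\<forall>k<n. q k = p k" for q
  proof -
    have "q i \<in> U i" for i
    proof (cases "U i = UNIV")
      case False
      with n q have "q i = p i" by simp
      then show ?thesis using PiE_mem[OF U(1), of i] by simp
    qed simp
    then have "q \<in> PiE UNIV U" by (simp add: PiE_iff)
    with U(2) show ?thesis by (rule subsetD)
  qed
  then show ?thesis by blast
qed

lemma second_countable_baire: "second_countable baire"
proof -
  \<comment> \<open>Cylinders indexed by finite sequences; there are countably many since lists over
    \<open>nat\<close> are countable.\<close>
  define C where "C s = {q :: nat \<Rightarrow> nat. \<forall>k<length s. q k = s ! k}" for s
  have C_open: "openin baire (C s)" for s
  proof -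
    have "openin baire ((\<Inter>k\<in>{..<length s}. {q. q k \<in> {s ! k}}) \<inter> topspace baire)"
      by (intro openin_INT openin_baire_eval finite_lessThan)
    also have "(\<Inter>k\<in>{..<length s}. {q. q k \<in> {s ! k}}) \<inter> topspace baire = C s"
      by (auto simp: C_def)
    finally show ?thesis .
  qed
  have C_base: "\<exists>s. p \<in> C s \<and> C s \<subseteq> W" if "openin baire W" "p \<in> W" for W p
  proof -
    obtain n where n: "\<forall>q. (\<forall>k<n. q k = p k) \<longrightarrow> q \<in> W"
      using openin_baire_cylinder \<open>openin baire W\<close> \<open>p \<in> W\<close> by blast
    have "p \<in> C (map p [0..<n])"
      by (simp add: C_def)
    moreover have "C (map p [0..<n]) \<subseteq> W"
      using n by (simp add: C_def subset_iff)
    ultimately show ?thesis by blast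
  qed
  have "countable (range C)"
    by simp
  moreover have "\<forall>V\<in>range C. openin baire V"
    using C_open by simp
  moreover have "\<forall>W p. openin baire W \<and> p \<in> W \<longrightarrow> (\<exists>V\<in>range C. p \<in> V \<and> V \<subseteq> W)"
    using C_base by simp
  ultimately show ?thesis
    unfolding second_countable_def by (intro exI[of _ "range C"] conjI)
qed

lemma completely_metrizable_space_baire: "completely_metrizable_space baire"
  unfolding baire_def
  by (simp add: completely_metrizable_space_product_topology completely_metrizable_space_discrete_topology)

text \<open>Both inclusions are countable conjunctions of open conditions: each value lies in
  \<open>N\<close>, and each element of \<open>N\<close> is attained. The fibres of the standard
  representation have this form, hence are Polish.\<close>

lemma gdelta_in_baire_range_eq: "gdelta_in baire {p. range p = N}"
proof -
  define \<T> where "\<T> = range (\<lambda>k. {p :: nat \<Rightarrow> nat. p k \<in> N}) \<union> (\<lambda>n. \<Union>k. {p. p k \<in> {n}}) ` N"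
  have "\<And>T. T \<in> \<T> \<Longrightarrow> openin baire T"
    unfolding \<T>_def by (elim UnE imageE) (simp_all only: openin_baire_eval openin_baire_range)
  moreover have "countable \<T>" "\<T> \<noteq> {}"
    by (simp_all add: \<T>_def)
  ultimately have "gdelta_in baire (\<Inter>\<T>)"
    by (intro gdelta_in_Inter open_imp_gdelta_in)
  also have "\<Inter>\<T> = {p. range p = N}"
  proof (rule set_eqI)
    fix p
    have "p \<in> \<Inter>\<T> \<longleftrightarrow> (\<forall>k. p k \<in> N) \<and> (\<forall>n\<in>N. \<exists>k. p k = n)"
      by (simp add: \<T>_def ball_Un)
    also have "\<dots> \<longleftrightarrow> range p \<subseteq> N \<and> N \<subseteq> range p"
      by (auto simp: image_subset_iff subset_iff image_iff eq_commute)
    finally show "p \<in> \<Inter>\<T> \<longleftrightarrow> p \<in> {p. range p = N}"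
      by (simp add: set_eq_subset)
  qed
  finally show ?thesis .
qed

text \<open>A name of a point is an enumeration of the indices of its basic neighbourhoods.  The base
  is required to cover every point so that each index set is non-empty and hence enumerable.\<close>
lemma standard_representation:
  assumes "second_countable X" "t0_space X"
  obtains E f where "continuous_map (subtopology baire E) X f"
    "open_surjection_complete_fibres (subtopology baire E) X f"
proof -
  obtain \<B> where \<B>: "countable \<B>" "\<forall>V \<in> \<B>. openin X V"
    "\<forall>U x. openin X U \<and> x \<in> U \<longrightarrow> (\<exists>V \<in> \<B>. x \<in> V \<and> V \<subseteq> U)"
    using assms(1) unfolding second_countable_def by blast
  define B where "B = from_nat_into (insert {} \<B>)"
  have rB: "range B = insert {} \<B>"
    using \<B>(1) by (simp add: range_from_nat_into B_def)
  have B_open: "openin X (B n)" for n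
    using \<B>(2) rB by (metis insertE openin_empty rangeI)
  have B_base: "\<exists>n. x \<in> B n \<and> B n \<subseteq> U" if "openin X U" "x \<in> U" for U x
    using \<B>(3) rB that by (metis insertI2 rangeE)
  define N where "N x = {n. x \<in> B n}" for x
  have N_inj: "x = y" if xy: "x \<in> topspace X" "y \<in> topspace X" "N x = N y" for x y
  proof (rule ccontr)
    assume "x \<noteq> y"
    then obtain U where "openin X U" "x \<notin> U \<longleftrightarrow> y \<in> U"
      using assms(2) xy unfolding t0_space_def by blast
    moreover have "x \<in> B n \<longleftrightarrow> y \<in> B n" for n
      using xy(3) unfolding N_def by blast
    ultimately show False
      using B_base by blast
  qed
  \<comment> \<open>\<open>E\<close> is the set of names. By \<open>N_inj\<close>, which rests on
    T0, a name determines its point, so the description in \<open>f\<close> is proper on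
    \<open>E\<close>.\<close>
  define E where "E = {p :: nat \<Rightarrow> nat. \<exists>x\<in>topspace X. range p = N x}"
  define f where "f p = (THE x. x \<in> topspace X \<and> range p = N x)" for p :: "nat \<Rightarrow> nat"
  have f_eq: "f p = x" if "x \<in> topspace X" "range p = N x" for p x
    unfolding f_def using that N_inj by (intro the_equality) auto
  have f_E: "f p \<in> topspace X \<and> range p = N (f p)" if "p \<in> E" for p
    using that f_eq unfolding E_def by auto
  have cont: "continuous_map (subtopology baire E) X f"
    unfolding continuous_map_def
  proof (intro conjI allI impI)
    show "f \<in> topspace (subtopology baire E) \<rightarrow> topspace X"
      using f_E by auto
    fix Q assume Q: "openin X Q"
    \<comment> \<open>A name lists every basic neighbourhood of its point, so membership in
      \<open>Q\<close> is confirmed by one entry, an open condition on \<open>p\<close>.\<close>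
    have "f p \<in> Q \<longleftrightarrow> (\<exists>k. p k \<in> {m. B m \<subseteq> Q})" if "p \<in> E" for p
    proof
      assume "f p \<in> Q"
      with B_base[OF Q] obtain n where "f p \<in> B n" "B n \<subseteq> Q" by blast
      moreover from this f_E[OF that] have "n \<in> range p"
        by (simp add: N_def)
      ultimately show "\<exists>k. p k \<in> {m. B m \<subseteq> Q}" by blast
    next
      assume "\<exists>k. p k \<in> {m. B m \<subseteq> Q}"
      then obtain k where "B (p k) \<subseteq> Q" by blast
      moreover have "p k \<in> N (f p)"
        using f_E[OF that] by blast
      ultimately show "f p \<in> Q"
        by (auto simp: N_def)
    qed
    then have "{p \<in> topspace (subtopology baire E). f p \<in> Q} = (\<Union>k. {p. p k \<in> {m. B m \<subseteq> Q}}) \<inter> E"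
      by auto
    with openin_baire_range[of "{m. B m \<subseteq> Q}"] show "openin (subtopology baire E) {p \<in> topspace (subtopology baire E). f p \<in> Q}"
      unfolding openin_subtopology by blast
  qed
  have N_enum: "\<exists>q :: nat \<Rightarrow> nat. range q = N x" if "x \<in> topspace X" for x
  proof -
    have "N x \<noteq> {}"
      using B_base[OF openin_topspace that] by (auto simp: N_def)
    then have "range (from_nat_into (N x)) = N x"
      by (simp add: range_from_nat_into)
    then show ?thesis by blast
  qed
  have opn: "open_map (subtopology baire E) X f"
    unfolding open_map_def
  proof (intro allI impI)
    fix U assume "openin (subtopology baire E) U"
    then obtain W where W: "openin baire W" "U = W \<inter> E"
      by (auto simp: openin_subtopology)
    show "openin X (f ` U)"
    proof (subst openin_subopen, intro ballI)
      fix x assume "x \<in> f ` U"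
      then obtain p where p: "p \<in> W" "p \<in> E" "f p = x"
        using W by auto
      have rp: "x \<in> topspace X" "range p = N x"
        using f_E[OF p(2)] p(3) by auto
      obtain n where n: "\<forall>q. (\<forall>k<n. q k = p k) \<longrightarrow> q \<in> W"
        using openin_baire_cylinder[OF W(1) p(1)] ..
      \<comment> \<open>\<open>Q\<close> collects the points some name of which can begin with the
        first \<open>n\<close> entries of \<open>p\<close>. Intersecting with
        \<open>topspace X\<close> covers the case \<open>n = 0\<close>.\<close>
      define Q where "Q = (\<Inter>k\<in>{..<n}. B (p k)) \<inter> topspace X"
      have "openin X Q"
        unfolding Q_def by (rule openin_INT) (auto intro: B_open)
      moreover have "x \<in> Q"
        using rp by (auto simp: Q_def N_def)
      moreover have "Q \<subseteq> f ` U"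
      proof
        fix y assume y: "y \<in> Q"
        then have yX: "y \<in> topspace X" by (simp add: Q_def)
        obtain e :: "nat \<Rightarrow> nat" where e: "range e = N y"
          using N_enum[OF yX] by blast
        \<comment> \<open>A name of \<open>y\<close> that copies \<open>p\<close> below
          \<open>n\<close>, hence lies in \<open>W\<close>, and then runs through \<open>e\<close>
          shifted by \<open>n\<close>. The copied entries are legitimate because \<open>y\<close>
          lies in \<open>Q\<close>.\<close>
        define q where "q k = (if k < n then p k else e (k - n))" for k
        have "range q = N y"
        proof
          show "range q \<subseteq> N y"
            using y e by (auto simp: q_def Q_def N_def)
          have "e k = q (k + n)" for k
            by (simp add: q_def)
          then show "N y \<subseteq> range q"
            unfolding e[symmetric] by auto
        qed
        then have "f q = y" "q \<in> E"
          using f_eq yX by (auto simp: E_def)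
        moreover have "q \<in> W"
          using n by (simp add: q_def)
        ultimately show "y \<in> f ` U"
          using W(2) by blast
      qed
      ultimately show "\<exists>T. openin X T \<and> x \<in> T \<and> T \<subseteq> f ` U"
        by blast
    qed
  qed
  have "open_surjection_complete_fibres (subtopology baire E) X f"
  proof
    show "f ` topspace (subtopology baire E) = topspace X"
    proof
      show "f ` topspace (subtopology baire E) \<subseteq> topspace X"
        using f_E by auto
      show "topspace X \<subseteq> f ` topspace (subtopology baire E)"
      proof
        fix x assume x: "x \<in> topspace X"
        then obtain q :: "nat \<Rightarrow> nat" where "range q = N x" using N_enum by blast
        with x have "q \<in> E" "f q = x" using f_eq by (auto simp: E_def)
        then show "x \<in> f ` topspace (subtopology baire E)" by auto
      qed
    qed
    show "second_countable (subtopology baire E)"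
      by (rule second_countable_subtopology[OF second_countable_baire])
    fix x assume x: "x \<in> topspace X"
    have "E \<inter> {z \<in> topspace (subtopology baire E). f z = x} = {p. range p = N x}"
      using x f_E f_eq by (auto simp: E_def)
    then show "completely_metrizable_space
        (subtopology (subtopology baire E) {z \<in> topspace (subtopology baire E). f z = x})"
      unfolding subtopology_subtopology
      using completely_metrizable_space_gdelta_in[OF completely_metrizable_space_baire gdelta_in_baire_range_eq]
      by simp
  qed (rule opn)
  with cont show thesis by (rule that)
qed

section \<open>Transfer to an arbitrary admissible representation\<close>

theorem theorem68:
  fixes X :: "'x topology" and D :: "(nat \<Rightarrow> nat) set" and \<rho> :: "(nat \<Rightarrow> nat) \<Rightarrow> 'x"
    and \<alpha> :: "'o::wellorder" and \<theta> :: "'p::wellorder" and S :: "'x set"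
  assumes "second_countable X" and "t0_space X"
    and "admissible_rep X D \<rho>"
    and "countable {\<beta>. \<beta> < \<alpha>}" and "\<exists>\<beta>. \<beta> < \<alpha>"
    and "countable {\<beta>. \<beta> < \<theta>}" and "\<exists>\<beta>. \<beta> < \<theta>"
    and "S \<subseteq> topspace X"
  shows "in_D_Sigma X \<alpha> \<theta> S \<longleftrightarrow> in_D_Sigma (subtopology baire D) \<alpha> \<theta> {p \<in> D. \<rho> p \<in> S}"
proof
  have \<rho>: "continuous_map (subtopology baire D) X \<rho>"
    using assms(3) by (simp add: admissible_rep_def pcont_def)
  assume "in_D_Sigma X \<alpha> \<theta> S"
  from in_D_Sigma_vimage[OF this \<rho>]
  show "in_D_Sigma (subtopology baire D) \<alpha> \<theta> {p \<in> D. \<rho> p \<in> S}" by simp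
next
  assume D: "in_D_Sigma (subtopology baire D) \<alpha> \<theta> {p \<in> D. \<rho> p \<in> S}"
  obtain E f where f: "continuous_map (subtopology baire E) X f"
    and "open_surjection_complete_fibres (subtopology baire E) X f"
    using standard_representation[OF assms(1,2)] by blast
  then interpret open_surjection_complete_fibres "subtopology baire E" X f
    by blast
  from assms(3) have "\<forall>Df f. pcont Df X f \<longrightarrow>
      (\<exists>Dg g. pcont Dg baire g \<and> Df = {p \<in> Dg. g p \<in> D} \<and> (\<forall>p\<in>Df. \<rho> (g p) = f p))"
    unfolding admissible_rep_def by (rule conjunct2)
  \<comment> \<open>Admissibility factors the standard representation through \<open>\<rho>\<close>;
    the domain equation for \<open>E\<close> ensures that \<open>g\<close> maps \<open>E\<close>
    into \<open>D\<close>.\<close>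
  from this[rule_format, of E f] f obtain Dg g where g: "continuous_map (subtopology baire Dg) baire g"
    and E: "E = {p \<in> Dg. g p \<in> D}" and fg: "\<forall>p\<in>E. \<rho> (g p) = f p"
    unfolding pcont_def by metis
  have "continuous_map (subtopology baire E) baire g"
    by (rule continuous_map_from_subtopology_mono[OF g]) (use E in blast)
  then have "continuous_map (subtopology baire E) (subtopology baire D) g"
    using E by (auto simp: continuous_map_in_subtopology)
  from in_D_Sigma_vimage[OF D this]
  have "in_D_Sigma (subtopology baire E) \<alpha> \<theta> {p \<in> E. g p \<in> D \<and> \<rho> (g p) \<in> S}"
    by simp
  \<comment> \<open>Pulling back along \<open>g\<close> yields the preimage of \<open>S\<close>
    under \<open>f\<close>, to which the descent along open surjections applies.\<close>
  also have "{p \<in> E. g p \<in> D \<and> \<rho> (g p) \<in> S} = {p \<in> topspace (subtopology baire E). f p \<in> S}"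
    using E fg by auto
  finally show "in_D_Sigma X \<alpha> \<theta> S"
    using assms(4,8) by (rule in_D_Sigma_of_vimage)
qed

end
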